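(* Let $\mathbb{K}$ be $\mathbb{R}$ or $\mathbb{C}$. If $E$ is an Archimedean vector lattice over $\mathbb{K}$ and $s\in\mathbb{N}\setminus\{1\}$, then there exists an $s$-power of $E$, unique up to vector lattice isomorphism.
   Context: A modulus on a $\mathbb{K}$-vector space $E$ is a map $m:E\to E$ with $m\circ m=m$ such that (1) $m(\alpha f)=|\alpha|m(f)$ for $\alpha\in\mathbb{K}$, $f\in E$; (2) $m\bigl(m(m(f)+m(g))-m(f+g)\bigr)=m(f)+m(g)-m(f+g)$ for $f,g\in E$; (3) $E$ is the $\mathbb{K}$-linear hull of $m(E)$. It is Archimedean if, for $f,g\in E$, $m(m(g)-nm(f))=m(g)-nm(f)$ for all $n\in\mathbb{N}$ implies $f=0$. An Archimedean vector lattice over $\mathbb{K}$ is a $\mathbb{K}$-vector space with an Archimedean modulus, written $|\cdot|$. Put $E^+=\{f\in E:|f|=f\}$ and $E_\rho=E^+-E^+$. Known facts (Mittelmeyer–Wolff): for $\mathbb{K}=\mathbb{R}$ these are exactly the usual Archimedean vector lattices with $|f|=f\vee(-f)$; for $\mathbb{K}=\mathbb{C}$, $E_\rho$ is an Archimedean real vector lattice with positive cone $E^+$, $E=E_\rho\oplus iE_\rho$, and $|f+ig|=\sup\{f\cos\theta+g\sin\theta:\theta\in[0,2\pi]\}$ (the supremum existing in $E_\rho$) for $f,g\in E_\rho$. A vector lattice homomorphism is a $\mathbb{K}$-linear map $T$ with $T(|f|)=|T(f)|$ for all $f$; a vector lattice isomorphism is a bijective one. Write $\times_sE=E\times\dots\times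 E$ ($s$ times). A map $T:\times_sE\to F$ that is $\mathbb{K}$-linear in each variable separately is a vector lattice $s$-morphism if for each $k$ and all fixed $f_j\in E^+$ $(j\ne k)$ the map $f_k\mapsto T(f_1,\dots,f_k,\dots,f_s)$ is a vector lattice homomorphism. A map $T:\times_sE\to F$ is orthosymmetric if $T(f_1,\dots,f_s)=0$ whenever there exist $i,j\in\{1,\dots,s\}$ such that $|f_i|\wedge|f_j|=0$. An $s$-power of $E$ is a pair $(E^{\circledS},\circledS)$ such that: (1) $E^{\circledS}$ is an Archimedean vector lattice over $\mathbb{K}$; (2) $\circledS:\times_sE\to E^{\circledS}$ is an orthosymmetric vector lattice $s$-morphism; (3) for every Archimedean vector lattice $F$ over $\mathbb{K}$ and every orthosymmetric vector lattice $s$-morphism $T:\times_sE\to F$ there exists a unique vector lattice homomorphism $T^{\circledS}:E^{\circledS}\to F$ such that $T^{\circledS}\circ\circledS=T$. *)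

theory Defs
  imports Complex_Main "HOL-Algebra.Module" "HOL-Algebra.Order" "HOL-Library.FuncSet"
begin

text \<open>The scalar field is a subfield \<open>K\<close> of the complex numbers, viewed as a ring in the
  sense of \<open>HOL-Algebra\<close>; the two fields of interest are \<open>K = \<real>\<close> and \<open>K = UNIV\<close>.\<close>

definition scalar_ring :: "complex set \<Rightarrow> complex ring" where
  "scalar_ring K = \<lparr>carrier = K, monoid.mult = (*), one = 1, ring.zero = 0, add = (+)\<rparr>"

text \<open>Only the module part of the record is used; its ring multiplication and unit
  play no role.\<close>

record 'a modulus_space = "(complex, 'a) module" +
  modulus :: "'a \<Rightarrow> 'a"

locale archimedean_vector_lattice =
  module "scalar_ring K" E for K :: "complex set" and E :: "'a modulus_space" (structure) +
  assumes modulus_closed: "f \<in> carrier E \<Longrightarrow> modulus E f \<in> carrier E"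
    and modulus_idem: "f \<in> carrier E \<Longrightarrow> modulus E (modulus E f) = modulus E f"
    and modulus_smult: "\<lbrakk>\<alpha> \<in> K; f \<in> carrier E\<rbrakk>
      \<Longrightarrow> modulus E (\<alpha> \<odot> f) = complex_of_real (cmod \<alpha>) \<odot> modulus E f"
    and modulus_add: "\<lbrakk>f \<in> carrier E; g \<in> carrier E\<rbrakk>
      \<Longrightarrow> modulus E (modulus E (modulus E f \<oplus> modulus E g) \<ominus> modulus E (f \<oplus> g))
            = modulus E f \<oplus> modulus E g \<ominus> modulus E (f \<oplus> g)"
    and modulus_hull: "(\<lambda>H. submodule H (scalar_ring K) E) hull (modulus E ` carrier E) = carrier E"
    and archimedean: "\<lbrakk>f \<in> carrier E; g \<in> carrier E;
        \<And>n :: nat. modulus E (modulus E g \<ominus> of_nat n \<odot> modulus E f)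
                      = modulus E g \<ominus> of_nat n \<odot> modulus E f\<rbrakk> \<Longrightarrow> f = \<zero>"

definition positive_cone :: "'a modulus_space \<Rightarrow> 'a set" where
  "positive_cone E = {f \<in> carrier E. modulus E f = f}"

text \<open>The ordered space \<open>E\<^sub>\<rho> = E\<^sup>+ - E\<^sup>+\<close>, in which infima of moduli are taken.\<close>

definition real_part :: "'a modulus_space \<Rightarrow> 'a gorder" where
  "real_part E = \<lparr>carrier = {p \<ominus>\<^bsub>E\<^esub> q |p q. p \<in> positive_cone E \<and> q \<in> positive_cone E},
                  eq = (=), le = (\<lambda>f g. g \<ominus>\<^bsub>E\<^esub> f \<in> positive_cone E)\<rparr>"

text \<open>\<open>\<bar>f\<bar> \<and> \<bar>g\<bar> = 0\<close>: zero is the greatest lower bound of the two moduli.\<close>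

definition disjoint_elements :: "'a modulus_space \<Rightarrow> 'a \<Rightarrow> 'a \<Rightarrow> bool" where
  "disjoint_elements E f g \<longleftrightarrow>
     greatest (real_part E) \<zero>\<^bsub>E\<^esub> (Lower (real_part E) {modulus E f, modulus E g})"

definition linear_map :: "complex set \<Rightarrow> 'a modulus_space \<Rightarrow> 'b modulus_space \<Rightarrow> ('a \<Rightarrow> 'b) \<Rightarrow> bool" where
  "linear_map K E F T \<longleftrightarrow> T \<in> carrier E \<rightarrow> carrier F
     \<and> (\<forall>f\<in>carrier E. \<forall>g\<in>carrier E. T (f \<oplus>\<^bsub>E\<^esub> g) = T f \<oplus>\<^bsub>F\<^esub> T g)
     \<and> (\<forall>\<alpha>\<in>K. \<forall>f\<in>carrier E. T (\<alpha> \<odot>\<^bsub>E\<^esub> f) = \<alpha> \<odot>\<^bsub>F\<^esub> T f)"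

definition vl_hom :: "complex set \<Rightarrow> 'a modulus_space \<Rightarrow> 'b modulus_space \<Rightarrow> ('a \<Rightarrow> 'b) \<Rightarrow> bool" where
  "vl_hom K E F T \<longleftrightarrow> linear_map K E F T \<and> (\<forall>f\<in>carrier E. T (modulus E f) = modulus F (T f))"

definition vl_iso :: "complex set \<Rightarrow> 'a modulus_space \<Rightarrow> 'b modulus_space \<Rightarrow> ('a \<Rightarrow> 'b) \<Rightarrow> bool" where
  "vl_iso K E F T \<longleftrightarrow> vl_hom K E F T \<and> bij_betw T (carrier E) (carrier F)"

definition tuples :: "nat \<Rightarrow> 'a modulus_space \<Rightarrow> (nat \<Rightarrow> 'a) set" where
  "tuples s E = {1..s} \<rightarrow>\<^sub>E carrier E"

definition multilinear ::
  "complex set \<Rightarrow> nat \<Rightarrow> 'a modulus_space \<Rightarrow> 'b modulus_space \<Rightarrow> ((nat \<Rightarrow> 'a) \<Rightarrow> 'b) \<Rightarrow> bool" where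
  "multilinear K s E F T \<longleftrightarrow>
     (\<forall>f\<in>tuples s E. \<forall>k\<in>{1..s}. linear_map K E F (\<lambda>x. T (f(k := x))))"

definition s_morphism ::
  "complex set \<Rightarrow> nat \<Rightarrow> 'a modulus_space \<Rightarrow> 'b modulus_space \<Rightarrow> ((nat \<Rightarrow> 'a) \<Rightarrow> 'b) \<Rightarrow> bool" where
  "s_morphism K s E F T \<longleftrightarrow> T \<in> tuples s E \<rightarrow> carrier F \<and> multilinear K s E F T
     \<and> (\<forall>f\<in>tuples s E. \<forall>k\<in>{1..s}. (\<forall>j\<in>{1..s} - {k}. f j \<in> positive_cone E)
           \<longrightarrow> vl_hom K E F (\<lambda>x. T (f(k := x))))"

definition orthosymmetric ::
  "nat \<Rightarrow> 'a modulus_space \<Rightarrow> 'b modulus_space \<Rightarrow> ((nat \<Rightarrow> 'a) \<Rightarrow> 'b) \<Rightarrow> bool" where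
  "orthosymmetric s E F T \<longleftrightarrow>
     (\<forall>f\<in>tuples s E. (\<exists>i\<in>{1..s}. \<exists>j\<in>{1..s}. disjoint_elements E (f i) (f j)) \<longrightarrow> T f = \<zero>\<^bsub>F\<^esub>)"

text \<open>\<open>s_power TYPE('f) K s E P \<tau>\<close>: the pair \<open>(P, \<tau>)\<close> is an \<open>s\<close>-power of \<open>E\<close>, where the
  universal property is tested on all Archimedean vector lattices with carrier in the type
  \<open>'f\<close>. The logic has no quantification over types inside a formula, so the type of the test
  spaces is a parameter. Homomorphisms are determined on the carrier only, hence
  uniqueness is among extensional functions.\<close>

definition s_power :: "'f itself \<Rightarrow> complex set \<Rightarrow> nat \<Rightarrow> 'a modulus_space
    \<Rightarrow> 'p modulus_space \<Rightarrow> ((nat \<Rightarrow> 'a) \<Rightarrow> 'p) \<Rightarrow> bool" where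
  "s_power _ K s E P \<tau> \<longleftrightarrow>
     archimedean_vector_lattice K P \<and> s_morphism K s E P \<tau> \<and> orthosymmetric s E P \<tau>
     \<and> (\<forall>(F :: 'f modulus_space) T.
          archimedean_vector_lattice K F \<and> s_morphism K s E F T \<and> orthosymmetric s E F T
          \<longrightarrow> (\<exists>!S. S \<in> extensional (carrier P) \<and> vl_hom K P F S
                 \<and> (\<forall>f\<in>tuples s E. S (\<tau> f) = T f)))"

text \<open>A type large enough to contain, for every \<open>E\<close> with carrier in \<open>'a\<close>, a copy of every
  vector lattice generated by the range of an \<open>s\<close>-morphism on \<open>E\<close>: its cardinality is at least
  the maximum of that of \<open>'a\<close> and the continuum.\<close>

type_synonym 'a universe = "'a list set"

end

theory Submission
  imports Defs "HOL-Library.Countable"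
begin

text \<open>
  The defining conditions on a modulus, on an \<open>s\<close>-morphism and on orthosymmetry are implications
  between equations, with the single exception of the condition on the linear hull; the
  Archimedean condition has infinitely many premises. Hence the formal terms built from tuples
  of elements of \<open>E\<close> with zero, addition, scalars and modulus carry a least congruence for which
  the quotient satisfies these conditions, and every orthosymmetric \<open>s\<close>-morphism factors
  through the quotient by induction on the congruence. The hull condition is inherited from \<open>E\<close>:
  an \<open>s\<close>-morphism maps tuples of positive elements to moduli, and these tuples span, by
  multilinearity, all others. The quotient fits into \<open>'a universe\<close> because formal terms can be
  coded by sets of lists.
\<close>

section \<open>Coding formal terms by sets of lists\<close>

datatype 'a formal_term =
    Zero
  | Gen "nat \<Rightarrow> 'a"
  | Add "'a formal_term" "'a formal_term"
  | Smul complex "'a formal_term"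
  | Mod "'a formal_term"

abbreviation Sub :: "'a formal_term \<Rightarrow> 'a formal_term \<Rightarrow> 'a formal_term" where
  "Sub t u \<equiv> Add t (Smul (-1) u)"

text \<open>Doubled lists have even length and determine the list that is doubled; one further
  element makes the length odd. Parity serves as the tag, so the pairing is injective even if
  \<open>'a\<close> has a single element.\<close>

definition pair_code :: "'a universe \<Rightarrow> 'a universe \<Rightarrow> 'a universe" where
  "pair_code A B = (\<lambda>l. l @ l) ` A \<union> (\<lambda>l. undefined # l @ l) ` B"

lemma pair_code_inject [simp]: "pair_code A B = pair_code C D \<longleftrightarrow> A = C \<and> B = D"
proof
  have double: "l @ l = m @ m \<longleftrightarrow> l = m" for l m :: "'a list"
  proof
    assume eq: "l @ l = m @ m"
    hence "length l + length l = length m + length m" by (metis length_append)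
    hence "length l = length m" by simp
    with eq show "l = m" by simp
  qed simp
  have parity: "l @ l \<noteq> undefined # m @ m" for l m :: "'a list"
  proof
    assume "l @ l = undefined # m @ m"
    hence "length l + length l = Suc (length m + length m)" by (metis length_append length_Cons)
    thus False by presburger
  qed
  have fst_code: "l @ l \<in> pair_code A B \<longleftrightarrow> l \<in> A" for l :: "'a list" and A B
    using parity by (auto simp: pair_code_def double)
  have snd_code: "undefined # l @ l \<in> pair_code A B \<longleftrightarrow> l \<in> B" for l :: "'a list" and A B
    using parity by (auto simp: pair_code_def double dest: sym)
  assume eq: "pair_code A B = pair_code C D"
  show "A = C \<and> B = D"
    using fst_code[of _ A B] fst_code[of _ C D] snd_code[of _ A B] snd_code[of _ C D]
    unfolding eq by blast
qed simp

text \<open>A number becomes the length of a list, which works over a one-element type as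
  well.\<close>

definition nat_set_code :: "nat set \<Rightarrow> 'a universe" where
  "nat_set_code N = (\<lambda>n. replicate n undefined) ` N"

lemma nat_set_code_inject [simp]: "nat_set_code M = nat_set_code N \<longleftrightarrow> M = N"
  unfolding nat_set_code_def
  by (rule inj_image_eq_iff) (metis injI length_replicate)

text \<open>The lower Dedekind cut of a real number, moved to the naturals by an enumeration of the
  rationals.\<close>

definition rat_cut :: "real \<Rightarrow> nat set" where
  "rat_cut r = to_nat ` {q :: rat. of_rat q < r}"

lemma rat_cut_inject [simp]: "rat_cut r = rat_cut r' \<longleftrightarrow> r = r'"
proof
  have distinct: "rat_cut a \<noteq> rat_cut b" if "a < b" for a b
  proof -
    obtain q where "a < real_of_rat q" "real_of_rat q < b"
      using of_rat_dense[OF \<open>a < b\<close>] by blast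
    hence "to_nat q \<in> rat_cut b" "to_nat q \<notin> rat_cut a"
      unfolding rat_cut_def by auto
    thus ?thesis by blast
  qed
  show "rat_cut r = rat_cut r' \<Longrightarrow> r = r'"
    using distinct by (metis linorder_neq_iff)
qed simp

text \<open>An infinite sequence is not a list, but the set of its finite initial segments
  determines it.\<close>

definition sequence_code :: "(nat \<Rightarrow> 'a) \<Rightarrow> 'a universe" where
  "sequence_code f = range (\<lambda>n. map f [0..<n])"

lemma sequence_code_inject [simp]: "sequence_code f = sequence_code g \<longleftrightarrow> f = g"
proof
  assume eq: "sequence_code f = sequence_code g"
  show "f = g"
  proof
    fix n
    have "map f [0..<Suc n] \<in> sequence_code f"
      unfolding sequence_code_def by (rule rangeI)
    then obtain m where m: "map f [0..<Suc n] = map g [0..<m]"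
      unfolding eq unfolding sequence_code_def by blast
    \<comment> \<open>Initial segments are told apart by their lengths; the last entry of this one
      is the value at \<open>n\<close>.\<close>
    hence "m = Suc n" by (metis length_map length_upt diff_zero)
    with m show "f n = g n" by simp
  qed
qed simp

text \<open>The leading number tags the constructor. A complex scalar enters as the cuts of its real
  and imaginary parts.\<close>

primrec term_code :: "'a formal_term \<Rightarrow> 'a universe" where
  "term_code Zero = pair_code (nat_set_code {0}) {}"
| "term_code (Gen f) = pair_code (nat_set_code {1}) (sequence_code f)"
| "term_code (Add t u) = pair_code (nat_set_code {2}) (pair_code (term_code t) (term_code u))"
| "term_code (Smul c t) = pair_code (nat_set_code {3}) (pair_code (term_code t)
      (pair_code (nat_set_code (rat_cut (Re c))) (nat_set_code (rat_cut (Im c)))))"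
| "term_code (Mod t) = pair_code (nat_set_code {4}) (term_code t)"

lemma inj_term_code: "inj term_code"
proof (rule injI)
  show "term_code t = term_code u \<Longrightarrow> t = u" for t u :: "'a formal_term"
  proof (induction t arbitrary: u)
    case Zero thus ?case by (cases u) auto
  next
    case (Gen f) thus ?case by (cases u) auto
  next
    case (Add t1 t2) thus ?case by (cases u) auto
  next
    case (Smul c t) thus ?case by (cases u) (auto simp: complex_eq_iff)
  next
    case (Mod t) thus ?case by (cases u) auto
  qed
qed

section \<open>The congruence on formal terms\<close>

lemma scalar_ring_simps [simp]:
  "carrier (scalar_ring K) = K" "mult (scalar_ring K) = (*)" "one (scalar_ring K) = 1"
  "zero (scalar_ring K) = 0" "add (scalar_ring K) = (+)"
  by (simp_all add: scalar_ring_def)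

definition scalar_field :: "complex set \<Rightarrow> bool" where
  "scalar_field K \<longleftrightarrow> K = \<real> \<or> K = UNIV"

lemma scalar_field_closed [simp]:
  assumes "scalar_field K"
  shows "0 \<in> K" "1 \<in> K" "-1 \<in> K" "of_nat n \<in> K" "complex_of_real x \<in> K"
    "a \<in> K \<Longrightarrow> b \<in> K \<Longrightarrow> a + b \<in> K" "a \<in> K \<Longrightarrow> b \<in> K \<Longrightarrow> a * b \<in> K"
  using assms unfolding scalar_field_def by auto

lemma module_add_neg:
  fixes M :: "(complex, 'b, 'm) module_scheme"
  assumes "module (scalar_ring K) M" "scalar_field K" "x \<in> carrier M"
  shows "x \<oplus>\<^bsub>M\<^esub> (-1) \<odot>\<^bsub>M\<^esub> x = \<zero>\<^bsub>M\<^esub>"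
proof -
  interpret M: module "scalar_ring K" M by fact
  show ?thesis
    using M.smult_l_distr[of 1 "-1" x] M.smult_l_null[of x] M.smult_one[of x] assms(2,3) by simp
qed

lemma module_neg:
  fixes M :: "(complex, 'b, 'm) module_scheme"
  assumes "module (scalar_ring K) M" "scalar_field K" "x \<in> carrier M"
  shows "\<ominus>\<^bsub>M\<^esub> x = (-1) \<odot>\<^bsub>M\<^esub> x"
proof -
  interpret M: module "scalar_ring K" M by fact
  show ?thesis
    using M.minus_equality[of "(-1) \<odot>\<^bsub>M\<^esub> x" x] M.smult_closed[of "-1" x] assms
      module_add_neg[OF assms] M.a_comm[of "(-1) \<odot>\<^bsub>M\<^esub> x" x] by simp
qed

lemma module_minus:
  fixes M :: "(complex, 'b, 'm) module_scheme"
  assumes "module (scalar_ring K) M" "scalar_field K" "y \<in> carrier M"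
  shows "x \<ominus>\<^bsub>M\<^esub> y = x \<oplus>\<^bsub>M\<^esub> (-1) \<odot>\<^bsub>M\<^esub> y"
  using module_neg[OF assms] by (simp add: a_minus_def)

text \<open>Closure under negatives comes from the scalar \<open>-1\<close>.\<close>

lemma submoduleI_scalar:
  fixes M :: "(complex, 'b, 'm) module_scheme"
  assumes "module (scalar_ring K) M" "scalar_field K"
    and "H \<subseteq> carrier M" "\<zero>\<^bsub>M\<^esub> \<in> H"
    and "\<And>x y. x \<in> H \<Longrightarrow> y \<in> H \<Longrightarrow> x \<oplus>\<^bsub>M\<^esub> y \<in> H"
    and "\<And>a x. a \<in> K \<Longrightarrow> x \<in> H \<Longrightarrow> a \<odot>\<^bsub>M\<^esub> x \<in> H"
  shows "submodule H (scalar_ring K) M"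
  using assms module_neg[OF assms(1,2)]
  by (intro module.submoduleI) (auto simp: subset_iff)

text \<open>Terms with a scalar outside \<open>K\<close> or with a sequence that is not a tuple over \<open>E\<close> are
  identified with zero, so that no well-formedness predicate is needed.\<close>

inductive term_cong ::
  "complex set \<Rightarrow> nat \<Rightarrow> 'a modulus_space \<Rightarrow> 'a formal_term \<Rightarrow> 'a formal_term \<Rightarrow> bool"
  for K :: "complex set" and s :: nat and E :: "'a modulus_space" where
  refl: "term_cong K s E t t"
| sym: "term_cong K s E t u \<Longrightarrow> term_cong K s E u t"
| trans: "term_cong K s E t u \<Longrightarrow> term_cong K s E u v \<Longrightarrow> term_cong K s E t v"
| cong_Add: "term_cong K s E t t' \<Longrightarrow> term_cong K s E u u' \<Longrightarrow> term_cong K s E (Add t u) (Add t' u')"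
| cong_Smul: "term_cong K s E t t' \<Longrightarrow> term_cong K s E (Smul c t) (Smul c t')"
| cong_Mod: "term_cong K s E t t' \<Longrightarrow> term_cong K s E (Mod t) (Mod t')"
| Gen_outside: "f \<notin> tuples s E \<Longrightarrow> term_cong K s E (Gen f) Zero"
| Smul_outside: "c \<notin> K \<Longrightarrow> term_cong K s E (Smul c t) Zero"
| Add_assoc: "term_cong K s E (Add (Add t u) v) (Add t (Add u v))"
| Add_comm: "term_cong K s E (Add t u) (Add u t)"
| Add_Zero: "term_cong K s E (Add Zero t) t"
| Add_neg: "term_cong K s E (Add t (Smul (-1) t)) Zero"
| Smul_l_distr: "a \<in> K \<Longrightarrow> b \<in> K \<Longrightarrow> term_cong K s E (Smul (a + b) t) (Add (Smul a t) (Smul b t))"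
| Smul_r_distr: "a \<in> K \<Longrightarrow> term_cong K s E (Smul a (Add t u)) (Add (Smul a t) (Smul a u))"
| Smul_assoc: "a \<in> K \<Longrightarrow> b \<in> K \<Longrightarrow> term_cong K s E (Smul (a * b) t) (Smul a (Smul b t))"
| Smul_one: "term_cong K s E (Smul 1 t) t"
| Mod_idem: "term_cong K s E (Mod (Mod t)) (Mod t)"
| Mod_Smul: "a \<in> K \<Longrightarrow> term_cong K s E (Mod (Smul a t)) (Smul (complex_of_real (cmod a)) (Mod t))"
| Mod_Add: "term_cong K s E (Mod (Sub (Mod (Add (Mod t) (Mod u))) (Mod (Add t u))))
                            (Sub (Add (Mod t) (Mod u)) (Mod (Add t u)))"
| archimedean: "(\<And>n :: nat. term_cong K s E (Mod (Sub (Mod u) (Smul (of_nat n) (Mod t))))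
                                            (Sub (Mod u) (Smul (of_nat n) (Mod t))))
    \<Longrightarrow> term_cong K s E t Zero"
| Gen_add: "\<lbrakk>f \<in> tuples s E; k \<in> {1..s}; x \<in> carrier E; y \<in> carrier E\<rbrakk>
    \<Longrightarrow> term_cong K s E (Gen (f(k := x \<oplus>\<^bsub>E\<^esub> y))) (Add (Gen (f(k := x))) (Gen (f(k := y))))"
| Gen_smult: "\<lbrakk>f \<in> tuples s E; k \<in> {1..s}; x \<in> carrier E; a \<in> K\<rbrakk>
    \<Longrightarrow> term_cong K s E (Gen (f(k := a \<odot>\<^bsub>E\<^esub> x))) (Smul a (Gen (f(k := x))))"
| Gen_modulus: "\<lbrakk>f \<in> tuples s E; k \<in> {1..s}; x \<in> carrier E;
      \<And>j. j \<in> {1..s} - {k} \<Longrightarrow> f j \<in> positive_cone E\<rbrakk>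
    \<Longrightarrow> term_cong K s E (Gen (f(k := modulus E x))) (Mod (Gen (f(k := x))))"
| Gen_disjoint: "\<lbrakk>f \<in> tuples s E; i \<in> {1..s}; j \<in> {1..s}; disjoint_elements E (f i) (f j)\<rbrakk>
    \<Longrightarrow> term_cong K s E (Gen f) Zero"

section \<open>Evaluation of formal terms in a test space\<close>

primrec eval :: "complex set \<Rightarrow> (nat \<Rightarrow> 'a) set \<Rightarrow> 'b modulus_space \<Rightarrow> ((nat \<Rightarrow> 'a) \<Rightarrow> 'b)
    \<Rightarrow> 'a formal_term \<Rightarrow> 'b" where
  "eval K G F T Zero = \<zero>\<^bsub>F\<^esub>"
| "eval K G F T (Gen f) = (if f \<in> G then T f else \<zero>\<^bsub>F\<^esub>)"
| "eval K G F T (Add t u) = eval K G F T t \<oplus>\<^bsub>F\<^esub> eval K G F T u"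
| "eval K G F T (Smul c t) = (if c \<in> K then c \<odot>\<^bsub>F\<^esub> eval K G F T t else \<zero>\<^bsub>F\<^esub>)"
| "eval K G F T (Mod t) = modulus F (eval K G F T t)"

lemma tuples_fun_upd:
  "f \<in> tuples s E \<Longrightarrow> k \<in> {1..s} \<Longrightarrow> x \<in> carrier E \<Longrightarrow> f(k := x) \<in> tuples s E"
  unfolding tuples_def by (auto simp: PiE_iff extensional_def)

lemma tuples_nth: "f \<in> tuples s E \<Longrightarrow> k \<in> {1..s} \<Longrightarrow> f k \<in> carrier E"
  unfolding tuples_def by auto

lemma eval_closed:
  assumes "archimedean_vector_lattice K F" "T \<in> G \<rightarrow> carrier F"
  shows "eval K G F T t \<in> carrier F"
proof -
  interpret F: archimedean_vector_lattice K F by fact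
  show ?thesis
    using assms(2) by (induction t) (auto intro!: F.modulus_closed)
qed

text \<open>Soundness of the congruence: each rule expresses a law of \<open>F\<close> or a property
  of \<open>T\<close>. This makes evaluation well defined on the quotient.\<close>

lemma eval_term_cong:
  assumes F: "archimedean_vector_lattice K F" and K: "scalar_field K"
    and E: "archimedean_vector_lattice K E"
    and T: "s_morphism K s E F T" "orthosymmetric s E F T"
    and "term_cong K s E t u"
  shows "eval K (tuples s E) F T t = eval K (tuples s E) F T u"
proof -
  interpret F: archimedean_vector_lattice K F by fact
  interpret E: archimedean_vector_lattice K E by fact
  let ?ev = "eval K (tuples s E) F T"
  have T_closed: "T \<in> tuples s E \<rightarrow> carrier F"
    using T(1) unfolding s_morphism_def by blast
  have cl [simp]: "?ev t \<in> carrier F" for t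
    using eval_closed[OF F T_closed] .
  have lin: "linear_map K E F (\<lambda>x. T (f(k := x)))" if "f \<in> tuples s E" "k \<in> {1..s}" for f k
    using T(1) that unfolding s_morphism_def multilinear_def by blast
  note K_simps [simp] = scalar_field_closed[OF K]
  have ev_Sub: "?ev (Sub t u) = ?ev t \<ominus>\<^bsub>F\<^esub> ?ev u" for t u
    using module_minus[OF F.module_axioms K] by simp
  from assms(6) show ?thesis
  proof (induction rule: term_cong.induct)
    case (Smul_l_distr a b t)
    thus ?case using F.smult_l_distr[of a b] by simp
  next
    case (Smul_r_distr a t u)
    thus ?case using F.smult_r_distr[of a] by simp
  next
    case (Smul_assoc a b t)
    thus ?case using F.smult_assoc1[of a b] by simp
  next
    case (Smul_one t)
    thus ?case using F.smult_one by simp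
  next
    case (Add_neg t)
    thus ?case using module_add_neg[OF F.module_axioms K] by simp
  next
    case (Mod_Add t u)
    show ?case unfolding eval.simps(5) ev_Sub using F.modulus_add by simp
  next
    case (Mod_idem t)
    thus ?case using F.modulus_idem by simp
  next
    case (Mod_Smul a t)
    thus ?case using F.modulus_smult by simp
  next
    \<comment> \<open>The induction hypotheses, one for each \<open>n\<close>, evaluate to the
      premises of the Archimedean property of \<open>F\<close>; the scalars \<open>of_nat n\<close>
      lie in \<open>K\<close>, so \<open>eval\<close> does not replace these multiples by
      zero.\<close>
    case (archimedean u t)
    thus ?case
      using F.archimedean[of "?ev t" "?ev u"] unfolding eval.simps(5) ev_Sub by simp
  next
    case (Gen_add f k x y)
    thus ?case using lin[of f k] by (simp add: tuples_fun_upd linear_map_def)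
  next
    case (Gen_smult f k x a)
    thus ?case using lin[of f k] by (simp add: tuples_fun_upd linear_map_def)
  next
    case (Gen_modulus f k x)
    hence "vl_hom K E F (\<lambda>x. T (f(k := x)))"
      using T(1) unfolding s_morphism_def by blast
    with Gen_modulus show ?case
      by (simp add: tuples_fun_upd vl_hom_def E.modulus_closed)
  next
    case (Gen_disjoint f i j)
    hence "T f = \<zero>\<^bsub>F\<^esub>" using T(2) unfolding orthosymmetric_def by blast
    thus ?case by simp
  \<comment> \<open>What remains are equivalence and compatibility rules, the laws of commutative
    addition, and \<open>Gen_outside\<close> and \<open>Smul_outside\<close>, which match the
    default zeros of \<open>eval\<close>.\<close>
  qed (simp_all add: F.a_ac)
qed

section \<open>The quotient\<close>

text \<open>A class is named by the code of one chosen representative instead of a set of terms;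
  this keeps the carrier inside \<open>'a universe\<close>.\<close>

definition term_class :: "complex set \<Rightarrow> nat \<Rightarrow> 'a modulus_space \<Rightarrow> 'a formal_term \<Rightarrow> 'a universe" where
  "term_class K s E t = term_code (SOME u. term_cong K s E t u)"

definition class_rep :: "complex set \<Rightarrow> nat \<Rightarrow> 'a modulus_space \<Rightarrow> 'a universe \<Rightarrow> 'a formal_term" where
  "class_rep K s E x = (SOME t. term_class K s E t = x)"

definition power_space :: "complex set \<Rightarrow> nat \<Rightarrow> 'a modulus_space \<Rightarrow> 'a universe modulus_space" where
  "power_space K s E =
    \<lparr>carrier = range (term_class K s E),
     monoid.mult = (\<lambda>x y. x),
     one = term_class K s E Zero,
     ring.zero = term_class K s E Zero,
     add = (\<lambda>x y. term_class K s E (Add (class_rep K s E x) (class_rep K s E y))),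
     module.smult = (\<lambda>c x. term_class K s E (Smul c (class_rep K s E x))),
     modulus = (\<lambda>x. term_class K s E (Mod (class_rep K s E x)))\<rparr>"

definition power_map :: "complex set \<Rightarrow> nat \<Rightarrow> 'a modulus_space \<Rightarrow> (nat \<Rightarrow> 'a) \<Rightarrow> 'a universe" where
  "power_map K s E f = term_class K s E (Gen f)"

text \<open>Congruent terms have the same set of congruent terms, so the choice operator picks the
  same one. Conversely, equal codes mean equal choices, and each term is congruent to its
  choice.\<close>

lemma term_class_eq_iff: "term_class K s E t = term_class K s E u \<longleftrightarrow> term_cong K s E t u"
proof
  have some: "term_cong K s E t (SOME u. term_cong K s E t u)" for t
    by (rule someI[of _ t]) (rule term_cong.refl)
  assume "term_class K s E t = term_class K s E u"
  hence "(SOME v. term_cong K s E t v) = (SOME v. term_cong K s E u v)"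
    unfolding term_class_def by (rule injD[OF inj_term_code])
  thus "term_cong K s E t u"
    using some[of t] some[of u] by (metis term_cong.sym term_cong.trans)
next
  assume "term_cong K s E t u"
  hence "term_cong K s E t v \<longleftrightarrow> term_cong K s E u v" for v
    using term_cong.sym term_cong.trans by meson
  hence "term_cong K s E t = term_cong K s E u" by (rule ext)
  thus "term_class K s E t = term_class K s E u" unfolding term_class_def by simp
qed

lemma term_class_rep: "term_class K s E (class_rep K s E (term_class K s E t)) = term_class K s E t"
  unfolding class_rep_def by (rule someI[of _ t]) (rule HOL.refl)

lemma rep_term_class: "term_cong K s E (class_rep K s E (term_class K s E t)) t"
  using term_class_rep[of K s E t] unfolding term_class_eq_iff .

text \<open>The compatibility rules of the congruence make the operations independent of
  representatives, so later calculations take place on terms.\<close>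

lemma power_space_simps [simp]:
  "carrier (power_space K s E) = range (term_class K s E)"
  "\<zero>\<^bsub>power_space K s E\<^esub> = term_class K s E Zero"
  "term_class K s E t \<oplus>\<^bsub>power_space K s E\<^esub> term_class K s E u = term_class K s E (Add t u)"
  "c \<odot>\<^bsub>power_space K s E\<^esub> term_class K s E t = term_class K s E (Smul c t)"
  "modulus (power_space K s E) (term_class K s E t) = term_class K s E (Mod t)"
  by (simp_all add: power_space_def term_class_eq_iff term_cong.cong_Add term_cong.cong_Smul
      term_cong.cong_Mod rep_term_class)

lemma module_power_space:
  assumes K: "scalar_field K" and "cring (scalar_ring K)"
  shows "module (scalar_ring K) (power_space K s E)"
proof (rule moduleI)
  have neg: "term_class K s E (Add (Smul (-1) t) t) = term_class K s E Zero" for t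
    unfolding term_class_eq_iff by (metis term_cong.Add_neg term_cong.Add_comm term_cong.trans)
  show "abelian_group (power_space K s E)"
  proof (rule abelian_groupI)
    fix x assume "x \<in> carrier (power_space K s E)"
    then obtain t where t: "x = term_class K s E t" by auto
    show "\<exists>y\<in>carrier (power_space K s E). y \<oplus>\<^bsub>power_space K s E\<^esub> x = \<zero>\<^bsub>power_space K s E\<^esub>"
      by (rule bexI[of _ "term_class K s E (Smul (-1) t)"]) (simp_all add: t neg)
  qed (auto simp: term_class_eq_iff term_cong.Add_assoc term_cong.Add_comm term_cong.Add_Zero
      del: equalityI intro!: rangeI)
qed (use assms(2) in \<open>auto simp: term_class_eq_iff term_cong.Smul_l_distr term_cong.Smul_r_distr
    term_cong.Smul_assoc term_cong.Smul_one simp del: scalar_field_closed del: equalityI intro!: rangeI\<close>)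

lemma power_space_minus:
  assumes "scalar_field K" "cring (scalar_ring K)"
  shows "term_class K s E t \<ominus>\<^bsub>power_space K s E\<^esub> term_class K s E u = term_class K s E (Sub t u)"
  using module_minus[OF module_power_space[OF assms] assms(1), of "term_class K s E u"] by simp

text \<open>Induction on the finite set \<open>J\<close> of coordinates that are not assumed positive.\<close>

lemma power_map_in_submodule:
  assumes E: "archimedean_vector_lattice K E" and K: "scalar_field K" and "s \<ge> 1"
    and H: "submodule H (scalar_ring K) (power_space K s E)"
    and moduli: "range (\<lambda>t. term_class K s E (Mod t)) \<subseteq> H"
    and "f \<in> tuples s E" "J \<subseteq> {1..s}" "\<And>j. j \<in> {1..s} - J \<Longrightarrow> f j \<in> positive_cone E"
  shows "power_map K s E f \<in> H"
proof -
  interpret E: archimedean_vector_lattice K E by fact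
  have P: "module (scalar_ring K) (power_space K s E)"
    using module_power_space[OF K E.R.cring_axioms] .
  note sub = module.submoduleE[OF P H]
  have "finite J" using \<open>J \<subseteq> {1..s}\<close> finite_subset by blast
  thus ?thesis using assms(6-8)
  proof (induction J arbitrary: f)
    case empty
    \<comment> \<open>All coordinates are positive. Since \<open>s \<ge> 1\<close> there is a first
      one; it equals its own modulus, so \<open>Gen_modulus\<close> in that coordinate makes
      \<open>Gen f\<close> congruent to \<open>Mod (Gen f)\<close>.\<close>
    have one: "1 \<in> {1..s}" using \<open>s \<ge> 1\<close> by simp
    have "modulus E (f 1) = f 1"
      using empty(3)[of 1] one unfolding positive_cone_def by simp
    hence upd: "f(1 := modulus E (f 1)) = f" by simp
    have "term_cong K s E (Gen (f(1 := modulus E (f 1)))) (Mod (Gen (f(1 := f 1))))"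
      using empty one by (intro term_cong.Gen_modulus) (auto intro: tuples_nth)
    hence "power_map K s E f = term_class K s E (Mod (Gen f))"
      unfolding upd power_map_def term_class_eq_iff by simp
    thus ?case using moduli by blast
  next
    case (insert k J)
    have k: "k \<in> {1..s}" using insert by simp
    \<comment> \<open>These values of coordinate \<open>k\<close> include all moduli by the
      induction hypothesis and form a submodule, so the hull condition on \<open>E\<close> makes
      them all of \<open>carrier E\<close>.\<close>
    let ?L = "{x \<in> carrier E. power_map K s E (f(k := x)) \<in> H}"
    have smult: "power_map K s E (f(k := a \<odot>\<^bsub>E\<^esub> x)) \<in> H"
      if "a \<in> K" "x \<in> carrier E" "power_map K s E (f(k := x)) \<in> H" for a x
    proof -
      have "power_map K s E (f(k := a \<odot>\<^bsub>E\<^esub> x))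
          = a \<odot>\<^bsub>power_space K s E\<^esub> power_map K s E (f(k := x))"
        using term_cong.Gen_smult[OF \<open>f \<in> tuples s E\<close> k that(2,1)]
        by (simp add: power_map_def term_class_eq_iff)
      thus ?thesis using sub(4) that by simp
    qed
    have add: "power_map K s E (f(k := x \<oplus>\<^bsub>E\<^esub> y)) \<in> H"
      if "x \<in> carrier E" "y \<in> carrier E"
        "power_map K s E (f(k := x)) \<in> H" "power_map K s E (f(k := y)) \<in> H" for x y
    proof -
      have "power_map K s E (f(k := x \<oplus>\<^bsub>E\<^esub> y))
          = power_map K s E (f(k := x)) \<oplus>\<^bsub>power_space K s E\<^esub> power_map K s E (f(k := y))"
        using term_cong.Gen_add[OF \<open>f \<in> tuples s E\<close> k that(1,2)]
        by (simp add: power_map_def term_class_eq_iff)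
      thus ?thesis using sub(5) that by simp
    qed
    have pos: "modulus E x \<in> ?L" if "x \<in> carrier E" for x
    proof -
      have "modulus E x \<in> positive_cone E"
        using that E.modulus_closed E.modulus_idem by (simp add: positive_cone_def)
      thus ?thesis
        using insert.prems that E.modulus_closed k
        by (auto intro!: insert.IH tuples_fun_upd)
    qed
    \<comment> \<open>Zero is \<open>0\<close> times a modulus, and moduli already lie in
      \<open>?L\<close>.\<close>
    have zero: "\<zero>\<^bsub>E\<^esub> \<in> ?L"
      using smult[of 0 "modulus E \<zero>\<^bsub>E\<^esub>"] pos[of "\<zero>\<^bsub>E\<^esub>"] K E.smult_l_null[of "modulus E \<zero>\<^bsub>E\<^esub>"]
      by auto
    have "submodule ?L (scalar_ring K) E"
      by (rule submoduleI_scalar[OF E.module_axioms K])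
        (use zero add smult in auto)
    hence "(\<lambda>L. submodule L (scalar_ring K) E) hull (modulus E ` carrier E) \<subseteq> ?L"
      by (intro hull_minimal) (use pos in blast)
    hence "f k \<in> ?L"
      unfolding E.modulus_hull using tuples_nth[OF \<open>f \<in> tuples s E\<close> k] by blast
    thus ?case by simp
  qed
qed

text \<open>The laws of the modulus and the Archimedean property are rules of the congruence. Only
  the hull condition needs an argument, an induction on terms.\<close>

lemma archimedean_vector_lattice_power_space:
  assumes E: "archimedean_vector_lattice K E" and K: "scalar_field K" and s: "s \<ge> 1"
  shows "archimedean_vector_lattice K (power_space K s E)"
proof -
  interpret E: archimedean_vector_lattice K E by fact
  interpret P: module "scalar_ring K" "power_space K s E"
    using module_power_space[OF K E.R.cring_axioms] .
  note minus = power_space_minus[OF K E.R.cring_axioms]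
  have zero: "term_class K s E Zero \<in> H"
    if H: "submodule H (scalar_ring K) (power_space K s E)"
      and moduli: "range (\<lambda>t. term_class K s E (Mod t)) \<subseteq> H" for H
  proof -
    have "0 \<odot>\<^bsub>power_space K s E\<^esub> term_class K s E (Mod Zero) \<in> H"
      using P.submoduleE(4)[OF H, of 0 "term_class K s E (Mod Zero)"] moduli K by (simp add: image_subset_iff)
    thus ?thesis using P.smult_l_null[of "term_class K s E (Mod Zero)"] by simp
  qed
  have hull: "term_class K s E t \<in> H"
    if H: "submodule H (scalar_ring K) (power_space K s E)"
      and moduli: "range (\<lambda>t. term_class K s E (Mod t)) \<subseteq> H" for t H
  proof (induction t)
    case Zero
    thus ?case using zero[OF H moduli] .
  next
    case (Gen f)
    show ?case
    proof (cases "f \<in> tuples s E")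
      case True
      thus ?thesis
        \<comment> \<open>With \<open>J = {1..s}\<close> no coordinate is required to be
          positive.\<close>
        using power_map_in_submodule[OF E K s H moduli True, of "{1..s}"]
        by (simp add: power_map_def)
    next
      case False
      hence "term_class K s E (Gen f) = term_class K s E Zero"
        by (simp add: term_class_eq_iff term_cong.Gen_outside)
      thus ?thesis using zero[OF H moduli] by simp
    qed
  next
    case (Add t u)
    thus ?case using P.submoduleE(5)[OF H] by fastforce
  next
    case (Smul c t)
    show ?case
    proof (cases "c \<in> K")
      case True
      thus ?thesis using P.submoduleE(4)[OF H, of c] Smul by fastforce
    next
      case False
      hence "term_class K s E (Smul c t) = term_class K s E Zero"
        by (simp add: term_class_eq_iff term_cong.Smul_outside)
      thus ?thesis using zero[OF H moduli] by simp
    qed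
  next
    case (Mod t)
    thus ?case using moduli by blast
  qed
  show ?thesis
  proof (unfold_locales, goal_cases)
    case (1 f)
    thus ?case by auto
  next
    case (2 f)
    thus ?case by (auto simp: term_class_eq_iff del: equalityI intro: term_cong.Mod_idem)
  next
    case (3 \<alpha> f)
    thus ?case by (auto simp: term_class_eq_iff del: equalityI intro: term_cong.Mod_Smul)
  next
    case (4 f g)
    thus ?case by (auto simp: minus term_class_eq_iff del: equalityI intro: term_cong.Mod_Add)
  next
    case 5
    show ?case
    proof (rule hull_unique)
      show "submodule (carrier (power_space K s E)) (scalar_ring K) (power_space K s E)"
        by (rule P.carrier_is_submodule)
    next
      fix H
      assume moduli: "modulus (power_space K s E) ` carrier (power_space K s E) \<subseteq> H"
        and H: "submodule H (scalar_ring K) (power_space K s E)"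
      have "range (\<lambda>t. term_class K s E (Mod t)) \<subseteq> H"
        using moduli by (simp add: image_subset_iff)
      from hull[OF H this] show "carrier (power_space K s E) \<subseteq> H" by auto
    qed auto
  next
    case (6 f g)
    then obtain t u where tu: "f = term_class K s E t" "g = term_class K s E u" by auto
    have "term_cong K s E t Zero"
      by (rule term_cong.archimedean[of _ _ _ u])
        (use 6(3) in \<open>simp add: tu minus term_class_eq_iff\<close>)
    thus ?case by (simp add: tu term_class_eq_iff)
  qed
qed

section \<open>The universal property of the quotient\<close>

lemma linear_map_zero:
  assumes "module (scalar_ring K) E" "module (scalar_ring K) F" "scalar_field K"
    and T: "linear_map K E F T"
  shows "T \<zero>\<^bsub>E\<^esub> = \<zero>\<^bsub>F\<^esub>"
proof -
  interpret E: module "scalar_ring K" E by fact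
  interpret F: module "scalar_ring K" F by fact
  have "T (0 \<odot>\<^bsub>E\<^esub> \<zero>\<^bsub>E\<^esub>) = 0 \<odot>\<^bsub>F\<^esub> T \<zero>\<^bsub>E\<^esub>" "T \<zero>\<^bsub>E\<^esub> \<in> carrier F"
    using T scalar_field_closed(1)[OF assms(3)] E.M.zero_closed unfolding linear_map_def by blast+
  thus ?thesis using E.smult_l_null[of "\<zero>\<^bsub>E\<^esub>"] F.smult_l_null by simp
qed

text \<open>The rules for generators make \<open>power_map\<close> an orthosymmetric
  \<open>s\<close>-morphism, and evaluation provides the factorization. The test type
  \<open>'f\<close> is arbitrary, since the quotient is built without reference to it.\<close>

lemma s_power_power_space:
  assumes E: "archimedean_vector_lattice K E" and K: "scalar_field K" and s: "s \<ge> 1"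
  shows "s_power TYPE('f) K s E (power_space K s E) (power_map K s E)"
proof -
  interpret E: archimedean_vector_lattice K E by fact
  let ?P = "power_space K s E" and ?c = "term_class K s E" and ?\<tau> = "power_map K s E"
  have P: "archimedean_vector_lattice K ?P"
    using archimedean_vector_lattice_power_space[OF assms] .
  interpret P: archimedean_vector_lattice K ?P by fact
  have lin: "linear_map K E ?P (\<lambda>x. ?\<tau> (f(k := x)))" if "f \<in> tuples s E" "k \<in> {1..s}" for f k
    using that unfolding linear_map_def power_map_def
    by (auto simp: term_class_eq_iff del: equalityI intro: term_cong.Gen_add term_cong.Gen_smult)
  have mor: "s_morphism K s E ?P ?\<tau>"
    using lin unfolding s_morphism_def multilinear_def vl_hom_def
    by (auto simp: power_map_def term_class_eq_iff del: equalityI intro!: rangeI term_cong.Gen_modulus)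
  have ortho: "orthosymmetric s E ?P ?\<tau>"
    unfolding orthosymmetric_def power_map_def
    by (auto simp: term_class_eq_iff del: equalityI intro: term_cong.Gen_disjoint)
  have "\<exists>!S. S \<in> extensional (carrier ?P) \<and> vl_hom K ?P F S \<and> (\<forall>f\<in>tuples s E. S (?\<tau> f) = T f)"
    if F: "archimedean_vector_lattice K F"
      and T: "s_morphism K s E F T" "orthosymmetric s E F T" for F :: "'f modulus_space" and T
  proof -
    interpret F: archimedean_vector_lattice K F by fact
    let ?ev = "eval K (tuples s E) F T"
    have ev_closed: "?ev t \<in> carrier F" for t
      using eval_closed[OF F] T(1) unfolding s_morphism_def by blast
    \<comment> \<open>A factoring homomorphism is prescribed on generators and commutes with all
      operations, hence is evaluation; terms outside the syntax over \<open>K\<close> and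
      \<open>E\<close> are sent to zero on both sides.\<close>
    have determined: "S (?c t) = ?ev t"
      if S: "vl_hom K ?P F S" "\<forall>f\<in>tuples s E. S (?\<tau> f) = T f" for S t
    proof -
      have S_lin: "linear_map K ?P F S" using S(1) unfolding vl_hom_def by blast
      have S_add: "S (?c (Add t u)) = S (?c t) \<oplus>\<^bsub>F\<^esub> S (?c u)" for t u
        using S_lin unfolding linear_map_def by simp
      have S_smult: "S (?c (Smul a t)) = a \<odot>\<^bsub>F\<^esub> S (?c t)" if "a \<in> K" for a t
        using S_lin that unfolding linear_map_def by simp
      have S_mod: "S (?c (Mod t)) = modulus F (S (?c t))" for t
        using S(1) unfolding vl_hom_def by simp
      have S_zero: "S (?c Zero) = \<zero>\<^bsub>F\<^esub>"
        using linear_map_zero[OF P.module_axioms F.module_axioms K S_lin] by simp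
      have out: "f \<notin> tuples s E \<Longrightarrow> ?c (Gen f) = ?c Zero"
        "a \<notin> K \<Longrightarrow> ?c (Smul a t) = ?c Zero" for f a t
        by (simp_all add: term_class_eq_iff term_cong.Gen_outside term_cong.Smul_outside)
      show ?thesis
        using S(2) by (induction t) (auto simp: S_add S_smult S_mod S_zero out power_map_def)
    qed
    \<comment> \<open>Evaluation of a representative, whose choice is immaterial by
      \<open>eval_term_cong\<close>; the restriction makes the map extensional.\<close>
    let ?S = "restrict (\<lambda>x. ?ev (class_rep K s E x)) (carrier ?P)"
    have S: "?S (?c t) = ?ev t" for t
      using eval_term_cong[OF F K E T rep_term_class] by simp
    have "linear_map K ?P F ?S"
      unfolding linear_map_def using ev_closed S by (auto simp del: restrict_apply)
    hence "vl_hom K ?P F ?S"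
      unfolding vl_hom_def using S by (auto simp del: restrict_apply)
    moreover have "\<forall>f\<in>tuples s E. ?S (?\<tau> f) = T f"
      using S unfolding power_map_def by (simp del: restrict_apply)
    ultimately show ?thesis
    proof (intro ex1I[of _ ?S] conjI)
      fix S'
      assume S': "S' \<in> extensional (carrier ?P) \<and> vl_hom K ?P F S' \<and> (\<forall>f\<in>tuples s E. S' (?\<tau> f) = T f)"
      show "S' = ?S"
      proof (rule extensionalityI)
        fix x assume "x \<in> carrier ?P"
        then obtain t where "x = ?c t" by auto
        thus "S' x = ?S x" using S determined S' by metis
      qed (use S' in auto)
    qed auto
  qed
  thus ?thesis using P mor ortho unfolding s_power_def by blast
qed

section \<open>Uniqueness\<close>

lemma vl_hom_closed: "vl_hom K E F S \<Longrightarrow> x \<in> carrier E \<Longrightarrow> S x \<in> carrier F"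
  unfolding vl_hom_def linear_map_def by auto

lemma vl_hom_compose:
  assumes S: "vl_hom K E F S" and R: "vl_hom K F G R"
  shows "vl_hom K E G (\<lambda>x. R (S x))"
  using vl_hom_closed[OF S] vl_hom_closed[OF R] S R
  unfolding vl_hom_def linear_map_def by auto

lemma vl_hom_restrict:
  assumes P: "archimedean_vector_lattice K P" and S: "vl_hom K P F S"
  shows "vl_hom K P F (restrict S (carrier P))"
proof -
  interpret P: archimedean_vector_lattice K P by fact
  show ?thesis
    using S P.modulus_closed P.smult_closed unfolding vl_hom_def linear_map_def by auto
qed

lemma s_powerD:
  assumes "s_power TYPE('f) K s E P \<tau>"
  shows "archimedean_vector_lattice K P" "s_morphism K s E P \<tau>" "orthosymmetric s E P \<tau>"
  using assms unfolding s_power_def by blast+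

lemma s_power_factor:
  fixes F :: "'f modulus_space"
  assumes "s_power TYPE('f) K s E P \<tau>"
    and "archimedean_vector_lattice K F" "s_morphism K s E F T" "orthosymmetric s E F T"
  obtains S where "S \<in> extensional (carrier P)" "vl_hom K P F S" "\<forall>f\<in>tuples s E. S (\<tau> f) = T f"
  using assms unfolding s_power_def by blast

text \<open>The uniqueness clause of \<open>s_power\<close> concerns extensional maps. Applied to
  the restrictions of \<open>S\<close> and \<open>R\<close>, it yields agreement on the carrier for
  maps that are arbitrary elsewhere.\<close>

lemma s_power_unique:
  fixes F :: "'f modulus_space"
  assumes P: "s_power TYPE('f) K s E P \<tau>"
    and F: "archimedean_vector_lattice K F" "s_morphism K s E F T" "orthosymmetric s E F T"
    and S: "vl_hom K P F S" "\<forall>f\<in>tuples s E. S (\<tau> f) = T f"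
    and R: "vl_hom K P F R" "\<forall>f\<in>tuples s E. R (\<tau> f) = T f"
    and x: "x \<in> carrier P"
  shows "S x = R x"
proof -
  note P_avl = s_powerD(1)[OF P]
  have \<tau>: "\<tau> f \<in> carrier P" if "f \<in> tuples s E" for f
    using s_powerD(2)[OF P] that unfolding s_morphism_def by blast
  have ex1: "\<exists>!S. S \<in> extensional (carrier P) \<and> vl_hom K P F S \<and> (\<forall>f\<in>tuples s E. S (\<tau> f) = T f)"
    using P F unfolding s_power_def by blast
  have restr: "restrict U (carrier P) \<in> extensional (carrier P) \<and> vl_hom K P F (restrict U (carrier P))
      \<and> (\<forall>f\<in>tuples s E. restrict U (carrier P) (\<tau> f) = T f)"
    if "vl_hom K P F U" "\<forall>f\<in>tuples s E. U (\<tau> f) = T f" for U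
    using that \<tau> vl_hom_restrict[OF P_avl] by auto
  have "restrict S (carrier P) = restrict R (carrier P)"
    using ex1 restr[OF S] restr[OF R] by blast
  thus ?thesis using x by (metis restrict_apply')
qed

text \<open>The usual argument for universal objects: each structure map factors through the other,
  and both composites agree with identities by uniqueness. The four assumptions provide the four
  test situations: \<open>P\<close> and \<open>Q\<close>, each against itself and against the
  other.\<close>

lemma s_power_inverse_homs:
  fixes P :: "'p modulus_space" and Q :: "'q modulus_space"
  assumes Pp: "s_power TYPE('p) K s E P \<tau>" and Pq: "s_power TYPE('q) K s E P \<tau>"
    and Qp: "s_power TYPE('p) K s E Q \<sigma>" and Qq: "s_power TYPE('q) K s E Q \<sigma>"
  obtains S R where "vl_hom K P Q S" "vl_hom K Q P R"
    "\<forall>f\<in>tuples s E. S (\<tau> f) = \<sigma> f" "\<forall>f\<in>tuples s E. R (\<sigma> f) = \<tau> f"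
    "\<forall>x\<in>carrier P. R (S x) = x" "\<forall>y\<in>carrier Q. S (R y) = y"
proof -
  have id_hom: "vl_hom K M M (\<lambda>x. x)" for M
    unfolding vl_hom_def linear_map_def by simp
  obtain S where S: "vl_hom K P Q S" "\<forall>f\<in>tuples s E. S (\<tau> f) = \<sigma> f"
    using s_power_factor[OF Pq s_powerD[OF Qq]] .
  obtain R where R: "vl_hom K Q P R" "\<forall>f\<in>tuples s E. R (\<sigma> f) = \<tau> f"
    using s_power_factor[OF Qp s_powerD[OF Pp]] .
  have "R (S x) = x" if "x \<in> carrier P" for x
    using s_power_unique[OF Pp s_powerD[OF Pp] vl_hom_compose[OF S(1) R(1)] _ id_hom _ that] S R
    by simp
  moreover have "S (R y) = y" if "y \<in> carrier Q" for y
    using s_power_unique[OF Qq s_powerD[OF Qq] vl_hom_compose[OF R(1) S(1)] _ id_hom _ that] S R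
    by simp
  ultimately show thesis using that S R by blast
qed

text \<open>Universality of \<open>Q\<close> on the test type \<open>'f\<close> passes to
  \<open>P\<close>. If \<open>V\<close> factors \<open>T\<close> through \<open>\<sigma>\<close>,
  then \<open>V\<close> after \<open>S\<close> factors it through \<open>\<tau>\<close>. Any other
  factor \<open>U\<close> satisfies \<open>U (R y) = V y\<close> by uniqueness for \<open>Q\<close>,
  and \<open>y = S x\<close> gives \<open>U x = V (S x)\<close>.\<close>

lemma s_power_transfer:
  fixes P :: "'p modulus_space" and Q :: "'q modulus_space"
  assumes P: "s_power TYPE('p) K s E P \<tau>"
    and Q: "s_power TYPE('f) K s E Q \<sigma>"
    and S: "vl_hom K P Q S" "\<forall>f\<in>tuples s E. S (\<tau> f) = \<sigma> f"
    and R: "vl_hom K Q P R" "\<forall>f\<in>tuples s E. R (\<sigma> f) = \<tau> f"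
    and inverse: "\<forall>x\<in>carrier P. R (S x) = x"
  shows "s_power TYPE('f) K s E P \<tau>"
proof -
  note P_avl = s_powerD(1)[OF P]
  have \<tau>: "\<tau> f \<in> carrier P" if "f \<in> tuples s E" for f
    using s_powerD(2)[OF P] that unfolding s_morphism_def by blast
  have "\<exists>!U. U \<in> extensional (carrier P) \<and> vl_hom K P F U \<and> (\<forall>f\<in>tuples s E. U (\<tau> f) = T f)"
    if F: "archimedean_vector_lattice K F" "s_morphism K s E F T" "orthosymmetric s E F T"
    for F :: "'f modulus_space" and T
  proof -
    obtain V where V: "vl_hom K Q F V" "\<forall>f\<in>tuples s E. V (\<sigma> f) = T f"
      using s_power_factor[OF Q F] .
    let ?U = "restrict (\<lambda>x. V (S x)) (carrier P)"
    have "?U \<in> extensional (carrier P) \<and> vl_hom K P F ?U \<and> (\<forall>f\<in>tuples s E. ?U (\<tau> f) = T f)"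
      using vl_hom_restrict[OF P_avl vl_hom_compose[OF S(1) V(1)]] V S \<tau> by auto
    moreover have "U = ?U"
      if U: "U \<in> extensional (carrier P) \<and> vl_hom K P F U \<and> (\<forall>f\<in>tuples s E. U (\<tau> f) = T f)" for U
    proof (rule extensionalityI)
      fix x assume x: "x \<in> carrier P"
      have "U (R y) = V y" if "y \<in> carrier Q" for y
        using s_power_unique[OF Q F vl_hom_compose[OF R(1)] _ V that] U R by simp
      from this[OF vl_hom_closed[OF S(1) x]] show "U x = ?U x"
        using inverse x by simp
    qed (use U in auto)
    ultimately show ?thesis by (rule ex1I)
  qed
  thus ?thesis using s_powerD[OF P] unfolding s_power_def by blast
qed

text \<open>The type variable \<open>'f\<close> is arbitrary, so the second conjunct recovers the
  universal property for test spaces in any type from the one on \<open>'a universe\<close>. In the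
  third, the powers may live in different types, and the test types are those that the inverse
  homomorphisms call for.\<close>

theorem theorem5p3:
  fixes K :: "complex set" and s :: nat and E :: "'a modulus_space"
  assumes "K = \<real> \<or> K = UNIV"
    and "archimedean_vector_lattice K E"
    and "s \<ge> 2"
  shows
    "(\<exists>(P :: 'a universe modulus_space) \<tau>. s_power TYPE('a universe) K s E P \<tau>)
     \<and> (\<forall>(P :: 'a universe modulus_space) \<tau>.
          s_power TYPE('a universe) K s E P \<tau> \<longrightarrow> s_power TYPE('f) K s E P \<tau>)
     \<and> (\<forall>(P :: 'p modulus_space) \<tau> (Q :: 'q modulus_space) \<sigma>.
          s_power TYPE('p) K s E P \<tau> \<and> s_power TYPE('q) K s E P \<tau>
          \<and> s_power TYPE('p) K s E Q \<sigma> \<and> s_power TYPE('q) K s E Q \<sigma>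
          \<longrightarrow> (\<exists>S. vl_iso K P Q S \<and> (\<forall>f\<in>tuples s E. S (\<tau> f) = \<sigma> f)))"
proof (intro conjI allI impI)
  have K: "scalar_field K" using assms(1) unfolding scalar_field_def .
  have s: "s \<ge> 1" using assms(3) by simp
  \<comment> \<open>The test type is still schematic here, so \<open>power\<close> serves for
    \<open>'a universe\<close> and for \<open>'f\<close>.\<close>
  note power = s_power_power_space[OF assms(2) K s]
  show "\<exists>(P :: 'a universe modulus_space) \<tau>. s_power TYPE('a universe) K s E P \<tau>"
    using power by blast
  show "s_power TYPE('f) K s E P \<tau>"
    if P: "s_power TYPE('a universe) K s E P \<tau>" for P :: "'a universe modulus_space" and \<tau>
  proof -
    obtain S R where "vl_hom K P (power_space K s E) S" "vl_hom K (power_space K s E) P R"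
      "\<forall>f\<in>tuples s E. S (\<tau> f) = power_map K s E f" "\<forall>f\<in>tuples s E. R (power_map K s E f) = \<tau> f"
      "\<forall>x\<in>carrier P. R (S x) = x"
      "\<forall>y\<in>carrier (power_space K s E). S (R y) = y"
      using s_power_inverse_homs[OF P P power power] .
    \<comment> \<open>The quotient has the universal property on \<open>'f\<close>, and the
      isomorphism carries it over to \<open>P\<close>.\<close>
    thus ?thesis by (intro s_power_transfer[OF P power])
  qed
  show "\<exists>S. vl_iso K P Q S \<and> (\<forall>f\<in>tuples s E. S (\<tau> f) = \<sigma> f)"
    if PQ: "s_power TYPE('p) K s E P \<tau> \<and> s_power TYPE('q) K s E P \<tau>
      \<and> s_power TYPE('p) K s E Q \<sigma> \<and> s_power TYPE('q) K s E Q \<sigma>"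
    for P :: "'p modulus_space" and \<tau> and Q :: "'q modulus_space" and \<sigma>
  proof -
    obtain S R where SR: "vl_hom K P Q S" "vl_hom K Q P R"
      "\<forall>f\<in>tuples s E. S (\<tau> f) = \<sigma> f" "\<forall>f\<in>tuples s E. R (\<sigma> f) = \<tau> f"
      "\<forall>x\<in>carrier P. R (S x) = x" "\<forall>y\<in>carrier Q. S (R y) = y"
      using s_power_inverse_homs[OF PQ[THEN conjunct1] PQ[THEN conjunct2, THEN conjunct1]
        PQ[THEN conjunct2, THEN conjunct2, THEN conjunct1]
        PQ[THEN conjunct2, THEN conjunct2, THEN conjunct2]] .
    have "bij_betw S (carrier P) (carrier Q)"
      by (rule bij_betw_byWitness[where f' = R])
        (use SR vl_hom_closed[OF SR(1)] vl_hom_closed[OF SR(2)] in auto)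
    thus ?thesis using SR unfolding vl_iso_def by blast
  qed
qed

end
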